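(* Let $n\ge3$. The Hilbert polynomial $P_{\mathcal A_{\mathcal P_n}}(x)$ of the graded algebra $\mathcal A_{\mathcal P_n}$ is $x^{\lfloor\frac{n-1}{2}\rfloor}\mathcal P_n\!\left(\frac1x\right)$.
   Context: $[n]=\{1,\dots,n\}$; $\mathfrak S_n$ is the set of permutations of $[n]$ in one-line notation. The circular peak set of $\sigma\in\mathfrak S_n$ is $CP(\sigma)=\{\sigma(i)\mid 2\le i\le n-1,\ \sigma(i-1)<\sigma(i)>\sigma(i+1)\}$; for $S\subseteq[n]$, $CP_n(S)=\{\sigma\in\mathfrak S_n\mid CP(\sigma)=S\}$, and $\mathcal P_n=\{S\subseteq[n]\mid CP_n(S)\neq\emptyset\}$, ordered by inclusion. For $i\ge-1$, $p_{n,i}$ is the number of $S\in\mathcal P_n$ with $|S|=i+1$, and $\mathcal P_n(x)=\sum_{i=0}^{\lfloor\frac{n-1}{2}\rfloor}p_{n,i-1}x^{\lfloor\frac{n-1}{2}\rfloor-i}$. Fix a field $\mathbb K$, let $m=|\mathcal P_n|$ and enumerate $\mathcal P_n=\{S_{n,1},\dots,S_{n,m}\}$. $\mathcal I_{\mathcal P_n}\subseteq\mathbb K[x_1,\dots,x_m]$ is the ideal generated by all $x_ix_j$ such that $S_{n,i}$ and $S_{n,j}$ are incomparable under inclusion, and $\mathcal A_{\mathcal P_n}=\mathbb K[x_1,\dots,x_m]/\mathcal I_{\mathcal P_n}$, graded by degree. The Hilbert polynomial of a graded algebra $\mathcal A=\bigoplus_{k\ge0}\mathcal A^k$ is the polynomial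 $P_{\mathcal A}$ with rational coefficients such that $P_{\mathcal A}(k)=\dim\mathcal A^k$ for all sufficiently large $k$. *)

theory Defs
  imports
    "HOL-Combinatorics.Permutations"
    "HOL-Library.Poly_Mapping"
    "HOL-Computational_Algebra.Polynomial"
    "HOL-Algebra.QuotRing"
    "HOL-Algebra.Embedded_Algebras"
begin

section \<open>Circular peak sets\<close>

definition circular_peak_set :: "nat \<Rightarrow> (nat \<Rightarrow> nat) \<Rightarrow> nat set" where
  "circular_peak_set n \<sigma> =
     {\<sigma> i | i. 2 \<le> i \<and> i \<le> n - 1 \<and> \<sigma> (i - 1) < \<sigma> i \<and> \<sigma> i > \<sigma> (i + 1)}"

definition CP :: "nat \<Rightarrow> nat set \<Rightarrow> (nat \<Rightarrow> nat) set" where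
  "CP n S = {\<sigma>. \<sigma> permutes {1..n} \<and> circular_peak_set n \<sigma> = S}"

definition peak_poset :: "nat \<Rightarrow> nat set set" where
  "peak_poset n = {S. S \<subseteq> {1..n} \<and> CP n S \<noteq> {}}"

text \<open>The index \<open>i\<close> is an integer because \<open>p\<^sub>n\<^sub>,\<^sub>i\<close> starts at \<open>i = -1\<close>.\<close>

definition peak_number :: "nat \<Rightarrow> int \<Rightarrow> nat" where
  "peak_number n i = card {S \<in> peak_poset n. int (card S) = i + 1}"

definition peak_polynomial :: "nat \<Rightarrow> rat poly" where
  "peak_polynomial n =
     (\<Sum>i = 0..(n - 1) div 2.
        Polynomial.monom (of_nat (peak_number n (int i - 1))) ((n - 1) div 2 - i))"


section \<open>Polynomial rings in several variables\<close>

text \<open>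
  A polynomial with coefficients in \<open>'k\<close> is a finitely supported map from exponent vectors to
  coefficients, an exponent vector being a finitely supported map from variable indices to
  exponents. The type has infinitely many variables, so the polynomial ring in the variables
  \<open>x\<^sub>v\<close> with \<open>v \<in> V\<close> is cut out by its carrier.
\<close>

type_synonym 'k mpoly = "(nat \<Rightarrow>\<^sub>0 nat) \<Rightarrow>\<^sub>0 'k"

definition mpoly_ring :: "nat set \<Rightarrow> 'k::field mpoly ring" where
  "mpoly_ring V =
     \<lparr>carrier = {f. \<forall>t \<in> Poly_Mapping.keys f. Poly_Mapping.keys t \<subseteq> V},
      mult = times, one = 1, zero = 0, add = plus\<rparr>"

definition mvar :: "nat \<Rightarrow> 'k::field mpoly" where
  "mvar v = Poly_Mapping.single (Poly_Mapping.single v 1) 1"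

definition mconst :: "'k::field \<Rightarrow> 'k mpoly" where
  "mconst c = Poly_Mapping.single 0 c"

definition total_degree :: "(nat \<Rightarrow>\<^sub>0 nat) \<Rightarrow> nat" where
  "total_degree t = (\<Sum>v \<in> Poly_Mapping.keys t. Poly_Mapping.lookup t v)"

text \<open>The zero polynomial is homogeneous of every degree.\<close>

definition homogeneous :: "nat \<Rightarrow> 'k::field mpoly \<Rightarrow> bool" where
  "homogeneous k f \<longleftrightarrow> (\<forall>t \<in> Poly_Mapping.keys f. total_degree t = k)"


section \<open>The algebra of an enumerated family of sets\<close>

text \<open>The family is \<open>S 1, \<dots>, S m\<close>, ordered by inclusion.\<close>

definition incomparability_ideal :: "nat \<Rightarrow> (nat \<Rightarrow> nat set) \<Rightarrow> 'k::field mpoly set" where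
  "incomparability_ideal m S =
     Idl\<^bsub>mpoly_ring {1..m}\<^esub>
       {mvar i * mvar j | i j. i \<in> {1..m} \<and> j \<in> {1..m} \<and> \<not> S i \<subseteq> S j \<and> \<not> S j \<subseteq> S i}"

definition chain_algebra :: "nat \<Rightarrow> (nat \<Rightarrow> nat set) \<Rightarrow> 'k::field mpoly set ring" where
  "chain_algebra m S = mpoly_ring {1..m} Quot incomparability_ideal m S"

text \<open>The copy of the ground field inside the quotient, which provides the scalar action.\<close>

definition chain_scalars :: "nat \<Rightarrow> (nat \<Rightarrow> nat set) \<Rightarrow> 'k::field mpoly set set" where
  "chain_scalars m S =
     {incomparability_ideal m S +>\<^bsub>mpoly_ring {1..m}\<^esub> mconst c | c. True}"

definition chain_component :: "nat \<Rightarrow> (nat \<Rightarrow> nat set) \<Rightarrow> nat \<Rightarrow> 'k::field mpoly set set" where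
  "chain_component m S k =
     {incomparability_ideal m S +>\<^bsub>mpoly_ring {1..m}\<^esub> f | f.
        f \<in> carrier (mpoly_ring {1..m}) \<and> homogeneous k f}"


section \<open>Hilbert polynomials\<close>

text \<open>
  Here \<open>A\<close> is a ring containing the field \<open>K\<close>, and \<open>G k\<close> is its homogeneous component of
  degree \<open>k\<close>, a subspace of \<open>A\<close> over \<open>K\<close>.
\<close>

definition is_hilbert_polynomial ::
  "'a ring \<Rightarrow> 'a set \<Rightarrow> (nat \<Rightarrow> 'a set) \<Rightarrow> rat poly \<Rightarrow> bool" where
  "is_hilbert_polynomial A K G P \<longleftrightarrow>
     (\<exists>N. \<forall>k \<ge> N. \<exists>d. ring.dimension A d K (G k) \<and> poly P (of_nat k) = of_nat d)"

definition hilbert_polynomial :: "'a ring \<Rightarrow> 'a set \<Rightarrow> (nat \<Rightarrow> 'a set) \<Rightarrow> rat poly" where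
  "hilbert_polynomial A K G = (THE P. is_hilbert_polynomial A K G P)"

end

(*
  A set S is a circular peak set iff every s in S satisfies |S \<inter> [s]| < |[s] - S|: the r peaks of
  value at most s have at least r + 1 distinct smaller neighbours, none of which is a peak.
  Hence P_n is closed under subsets and its members have at most (n - 1) div 2 elements.

  The incomparability ideal is spanned by the monomials whose support is not a chain, so the
  degree k component of the algebra has the chain monomials of degree k as a basis. These are the
  multichains of k members of P_n. As P_n is closed under subsets, those with largest member X
  number k ^ |X|, so for k > 0 the dimension is the sum of k ^ |X| over all X in P_n.
*)
theory Submission
  imports Defs
begin

section \<open>Characterization of circular peak sets\<close>

text \<open>Reading the values 1, 2, ... in order, non-members stay strictly ahead of members, as in
  the ballot problem. Testing at members of \<open>S\<close> is enough, because a value outside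
  \<open>S\<close> only increases the lead.\<close>

definition ballot_set :: "nat \<Rightarrow> nat set \<Rightarrow> bool" where
  "ballot_set n S \<longleftrightarrow> S \<subseteq> {1..n} \<and> (\<forall>s\<in>S. card (S \<inter> {1..s}) < card ({1..s} - S))"

text \<open>Two peaks are never adjacent, so the right neighbours of the peaks of value at most
  \<open>s\<close>, together with the left neighbour of the leftmost of them, are smaller non-peaks,
  one more in number than those peaks.\<close>

lemma circular_peak_set_ballot:
  assumes \<sigma>: "\<sigma> permutes {1..n}"
  shows "ballot_set n (circular_peak_set n \<sigma>)"
proof -
  define S where "S = circular_peak_set n \<sigma>"
  have inj: "\<sigma> x = \<sigma> y \<longleftrightarrow> x = y" for x y
    using permutes_inj[OF \<sigma>] by (auto dest: injD)
  have rng: "\<sigma> x \<in> {1..n} \<longleftrightarrow> x \<in> {1..n}" for x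
    using permutes_in_image[OF \<sigma>] .
  have sub: "S \<subseteq> {1..n}"
  proof
    fix x assume "x \<in> S"
    then obtain i where "x = \<sigma> i" "2 \<le> i" "i \<le> n - 1"
      by (auto simp: S_def circular_peak_set_def)
    then show "x \<in> {1..n}" using rng[of i] by auto
  qed
  have "card (S \<inter> {1..s}) < card ({1..s} - S)" if s: "s \<in> S" for s
  proof -
    define J where
      "J = {i. 2 \<le> i \<and> i \<le> n - 1 \<and> \<sigma> (i - 1) < \<sigma> i \<and> \<sigma> i > \<sigma> (i + 1) \<and> \<sigma> i \<le> s}"
    have finJ: "finite J" by (rule finite_subset[of _ "{..n}"]) (auto simp: J_def)
    have SJ: "S \<inter> {1..s} = \<sigma> ` J"
      using sub by (auto simp: S_def J_def circular_peak_set_def)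
    have neJ: "J \<noteq> {}"
      using s sub SJ by fastforce
    have cJ: "card (S \<inter> {1..s}) = card J"
      unfolding SJ by (rule card_image) (auto simp: inj_on_def inj)
    define i0 where "i0 = Min J"
    have i0: "i0 \<in> J" "\<And>j. j \<in> J \<Longrightarrow> i0 \<le> j"
      using finJ neJ by (auto simp: i0_def)
    \<comment> \<open>The extra position is new: \<open>i0 - 1 = Suc j\<close> with \<open>j\<close>
      in \<open>J\<close> would contradict the minimality of \<open>i0\<close>.\<close>
    have cX: "card (insert (i0 - 1) (Suc ` J)) = Suc (card J)"
      using i0 finJ by (subst card_insert_disjoint) (auto simp: card_image dest!: i0(2))
    have "\<sigma> ` insert (i0 - 1) (Suc ` J) \<subseteq> {1..s} - S"
    proof -
      have "\<sigma> (i0 - 1) \<in> {1..s} - S"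
      proof -
        have "\<sigma> (i0 - 1) \<in> {1..n}" using i0(1) by (subst rng) (auto simp: J_def)
        moreover have "\<sigma> (i0 - 1) \<notin> S"
        \<comment> \<open>Peaks are recorded as values; injectivity of \<sigma> recovers the
          position, so this neighbour would have to exceed the peak beside it.\<close>
        proof
          assume "\<sigma> (i0 - 1) \<in> S"
          then have "\<sigma> (i0 - 1 + 1) < \<sigma> (i0 - 1)"
            by (auto simp: S_def circular_peak_set_def inj)
          with i0(1) show False by (auto simp: J_def)
        qed
        ultimately show ?thesis using i0(1) by (auto simp: J_def)
      qed
      moreover have "\<sigma> (Suc j) \<in> {1..s} - S" if j: "j \<in> J" for j
      proof -
        have "\<sigma> (Suc j) \<in> {1..n}" using j by (subst rng) (auto simp: J_def)
        moreover have "\<sigma> (Suc j) \<notin> S"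
        proof
          assume "\<sigma> (Suc j) \<in> S"
          then have "\<sigma> (Suc j - 1) < \<sigma> (Suc j)"
            unfolding S_def circular_peak_set_def by (auto simp only: inj mem_Collect_eq)
          with j show False by (auto simp: J_def)
        qed
        ultimately show ?thesis using j by (auto simp: J_def)
      qed
      ultimately show ?thesis by auto
    qed
    then have "card (\<sigma> ` insert (i0 - 1) (Suc ` J)) \<le> card ({1..s} - S)"
      by (rule card_mono[rotated]) simp
    moreover have "card (\<sigma> ` insert (i0 - 1) (Suc ` J)) = Suc (card J)"
      unfolding cX[symmetric] by (rule card_image) (auto simp: inj_on_def inj)
    ultimately show ?thesis using cJ by simp
  qed
  then show ?thesis using sub by (simp add: ballot_set_def S_def)
qed

text \<open>
  With peaks \<open>t\<^sub>1 < \<dots> < t\<^sub>k\<close> and remaining values \<open>c\<^sub>1 < c\<^sub>2 < \<dots>\<close>, the permutation is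
  \<open>c\<^sub>1 t\<^sub>1 c\<^sub>2 t\<^sub>2 \<dots> c\<^sub>k t\<^sub>k c\<^sub>k\<^sub>+\<^sub>1 c\<^sub>k\<^sub>+\<^sub>2 \<dots>\<close>; the ballot condition gives \<open>c\<^sub>j\<^sub>+\<^sub>1 < t\<^sub>j\<close>.
\<close>

lemma ballot_set_in_peak_poset:
  assumes S: "ballot_set n S" and n: "n > 0"
  shows "S \<in> peak_poset n"
proof -
  define tl cl where "tl = sorted_list_of_set S" and "cl = sorted_list_of_set ({1..n} - S)"
  define k where "k = card S"
  have sub: "S \<subseteq> {1..n}" and bal: "\<And>s. s \<in> S \<Longrightarrow> card (S \<inter> {1..s}) < card ({1..s} - S)"
    using S by (auto simp: ballot_set_def)
  have fin: "finite S" using sub finite_subset by blast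
  have st: "set tl = S" "length tl = k" and sc: "set cl = {1..n} - S"
    using fin by (auto simp: tl_def cl_def k_def)
  have lc: "length cl + k = n"
    using sub fin card_mono[OF _ sub] by (simp add: cl_def k_def card_Diff_subset)
  have tmono: "tl ! i < tl ! j" if "i < j" "j < k" for i j
    using that st strict_sorted_list_of_set[of S] unfolding tl_def
    by (intro sorted_wrt_nth_less[of "(<)"]) auto
  have cmono: "cl ! i < cl ! j" if "i < j" "j < length cl" for i j
    using that strict_sorted_list_of_set[of "{1..n} - S"] unfolding cl_def
    by (intro sorted_wrt_nth_less[of "(<)"]) auto
  have tinS: "tl ! j \<in> S" if "j < k" for j using that st nth_mem by blast
  have cin: "cl ! j \<in> {1..n} - S" if "j < length cl" for j using that sc nth_mem by blast
  \<comment> \<open>Lists are indexed from 0. If the claim failed, at most \<open>j + 1\<close>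
    non-members would lie below \<open>tl ! j\<close>, while the \<open>j + 1\<close> members up to
    index \<open>j\<close> are at most \<open>tl ! j\<close>; this contradicts the ballot condition
    there.\<close>
  have key: "Suc j < length cl \<and> cl ! Suc j < tl ! j" if j: "j < k" for j
  proof (rule ccontr)
    assume neg: "\<not> ?thesis"
    define t where "t = tl ! j"
    have tS: "t \<in> S" using tinS[OF j] by (simp add: t_def)
    have "{1..t} - S \<subseteq> (!) cl ` {..j}"
    proof
      fix x assume x: "x \<in> {1..t} - S"
      then have "x \<in> set cl" using tS sub sc by fastforce
      then obtain i where i: "i < length cl" "x = cl ! i" by (auto simp: in_set_conv_nth)
      have "i \<le> j"
      proof (rule ccontr)
        assume "\<not> i \<le> j"
        then have len: "Suc j < length cl" and "Suc j \<le> i" using i by auto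
        then have "cl ! Suc j \<le> cl ! i" using cmono[of "Suc j" i] i by (cases "i = Suc j") auto
        then have "cl ! Suc j \<le> t" using x i by auto
        moreover have "cl ! Suc j \<noteq> t" using cin[OF len] tS by auto
        ultimately show False using neg len by (auto simp: t_def)
      qed
      then show "x \<in> (!) cl ` {..j}" using i by auto
    qed
    then have "card ({1..t} - S) \<le> card ((!) cl ` {..j})" by (intro card_mono) auto
    also have "\<dots> \<le> Suc j" using card_image_le[of "{..j}" "(!) cl"] by simp
    finally have 1: "card ({1..t} - S) \<le> Suc j" .
    have "(!) tl ` {..j} \<subseteq> S \<inter> {1..t}"
    proof -
      have "tl ! i \<in> S \<inter> {1..t}" if "i \<le> j" for i
      proof -
        have "tl ! i \<in> S" using that j by (intro tinS) simp
        moreover have "tl ! i \<le> t"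
          using that tmono[of i j] j by (cases "i = j") (auto simp: t_def)
        ultimately show ?thesis using sub by auto
      qed
      then show ?thesis by auto
    qed
    then have "card ((!) tl ` {..j}) \<le> card (S \<inter> {1..t})" by (intro card_mono) auto
    moreover have "inj_on ((!) tl) {..j}"
    proof (rule linorder_inj_onI')
      fix a b assume "a \<in> {..j}" "b \<in> {..j}" "a < b"
      then show "tl ! a \<noteq> tl ! b" using tmono[of a b] j by auto
    qed
    ultimately have "Suc j \<le> card (S \<inter> {1..t})" by (simp add: card_image)
    with 1 bal[OF tS] show False by simp
  qed
  \<comment> \<open>There are at least \<open>k + 1\<close> non-members, enough to surround all
    \<open>k\<close> members in the alternating prefix.\<close>
  have kc: "k < length cl"
  proof (cases "k = 0")
    case True then show ?thesis using lc n by simp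
  next
    case False then show ?thesis using key[of "k - 1"] by simp
  qed
  \<comment> \<open>Position \<open>2 * j + 2\<close> carries \<open>tl ! j\<close> and position
    \<open>2 * j + 1\<close> carries \<open>cl ! j\<close>, up to position \<open>2 * k + 1\<close>.
    There the index \<open>i - 1 - k\<close> of the tail also equals \<open>k\<close>, so the two
    formulas overlap consistently.\<close>
  define \<sigma> where "\<sigma> i = (if i \<notin> {1..n} then i
      else if even i \<and> i \<le> 2 * k then tl ! (i div 2 - 1)
      else if i \<le> 2 * k + 1 then cl ! (i div 2) else cl ! (i - 1 - k))" for i
  have s_t: "\<sigma> (2 * j + 2) = tl ! j" if "j < k" for j
    using that kc lc by (auto simp: \<sigma>_def)
  have s_c: "\<sigma> (2 * j + 1) = cl ! j" if "j \<le> k" for j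
    using that kc lc by (auto simp: \<sigma>_def)
  have s_e: "\<sigma> i = cl ! (i - 1 - k)" if "2 * k + 1 \<le> i" "i \<le> n" for i
    using that kc lc by (auto simp: \<sigma>_def)
  have surj: "{1..n} \<subseteq> \<sigma> ` {1..n}"
  proof
    fix x assume x: "x \<in> {1..n}"
    show "x \<in> \<sigma> ` {1..n}"
    proof (cases "x \<in> S")
      case True
      then obtain j where "j < k" "x = tl ! j" using st by (metis in_set_conv_nth)
      then show ?thesis using s_t[of j] kc lc by (intro image_eqI[of _ _ "2 * j + 2"]) auto
    next
      case False
      then obtain j where j: "j < length cl" "x = cl ! j"
        using x sc by (metis DiffI in_set_conv_nth)
      show ?thesis
      proof (cases "j \<le> k")
        case True
        then show ?thesis using s_c[of j] j kc lc by (intro image_eqI[of _ _ "2 * j + 1"]) auto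
      next
        case False
        then show ?thesis using s_e[of "j + 1 + k"] j kc lc
          by (intro image_eqI[of _ _ "j + 1 + k"]) auto
      qed
    qed
  qed
  \<comment> \<open>On a finite set surjectivity already forces a bijection.\<close>
  then have im: "\<sigma> ` {1..n} = {1..n}"
    using card_seteq[OF _ surj] card_image_le[of "{1..n}" \<sigma>] by auto
  then have "inj_on \<sigma> {1..n}" by (intro eq_card_imp_inj_on) auto
  then have perm: "\<sigma> permutes {1..n}"
    using im by (intro bij_imp_permutes) (auto simp: bij_betw_def \<sigma>_def)
  have "circular_peak_set n \<sigma> = S"
  proof (intro subset_antisym subsetI)
    fix x assume "x \<in> S"
    then obtain j where j: "j < k" "x = tl ! j" using st by (metis in_set_conv_nth)
    have "\<sigma> (2 * j + 2 - 1) < \<sigma> (2 * j + 2)"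
      using s_c[of j] s_t[of j] key[of j] cmono[of j "Suc j"] j by (auto simp del: mult_Suc_right)
    moreover have "\<sigma> (2 * j + 2 + 1) < \<sigma> (2 * j + 2)"
      using s_c[of "Suc j"] s_t[of j] key[of j] j by (auto simp: eval_nat_numeral)
    ultimately show "x \<in> circular_peak_set n \<sigma>"
      unfolding circular_peak_set_def using j s_t[of j] kc lc
      by (intro CollectI exI[of _ "2 * j + 2"]) auto
  next
    fix x assume "x \<in> circular_peak_set n \<sigma>"
    then obtain i where i: "x = \<sigma> i" "2 \<le> i" "i \<le> n - 1" "\<sigma> (i - 1) < \<sigma> i" "\<sigma> (i + 1) < \<sigma> i"
      by (auto simp: circular_peak_set_def)
    \<comment> \<open>Even positions in the prefix hold members of \<open>S\<close>. An odd position
      \<open>i > 1\<close> of the prefix follows a larger member, and beyond the prefix the word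
      increases, so neither can be a peak.\<close>
    consider "even i" "i \<le> 2 * k" | "odd i" "i \<le> 2 * k + 1" | "i > 2 * k + 1"
      by fastforce
    then show "x \<in> S"
    proof cases
      case 1
      then obtain a where a: "i = 2 * a" by (auto elim: evenE)
      then obtain j where "a = Suc j" using i(2) by (cases a) auto
      then have "i = 2 * j + 2" "j < k" using a 1 by auto
      then show ?thesis using s_t i tinS by auto
    next
      case 2
      then obtain j where j: "i = 2 * j + 1" by (auto elim: oddE)
      then obtain l where l: "j = Suc l" using i(2) by (cases j) auto
      have "l < k" using 2 j l by auto
      then have "\<sigma> i < \<sigma> (i - 1)" using s_c[of j] s_t[of l] key[of l] j l by auto
      then show ?thesis using i by simp
    next
      case 3
      have "i - 1 - k < i - k" "i - k < length cl" using 3 i(2,3) lc by linarith+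
      then have "\<sigma> i < \<sigma> (i + 1)"
        using s_e[of i] s_e[of "i + 1"] 3 i lc cmono[of "i - 1 - k" "i - k"] by auto
      then show ?thesis using i by simp
    qed
  qed
  then show ?thesis using perm sub by (auto simp: peak_poset_def CP_def)
qed

section \<open>Consequences of the ballot criterion for the peak poset\<close>

lemma peak_poset_iff_ballot: "n > 0 \<Longrightarrow> S \<in> peak_poset n \<longleftrightarrow> ballot_set n S"
  using circular_peak_set_ballot ballot_set_in_peak_poset
  unfolding peak_poset_def CP_def by blast

text \<open>Shrinking the set moves values from the smaller count to the larger one.\<close>

lemma ballot_set_mono:
  assumes "ballot_set n S" "T \<subseteq> S"
  shows "ballot_set n T"
proof -
  have "card (T \<inter> {1..s}) < card ({1..s} - T)" if "s \<in> T" for s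
  proof -
    have "card (T \<inter> {1..s}) \<le> card (S \<inter> {1..s})" using assms(2) by (intro card_mono) auto
    also have "\<dots> < card ({1..s} - S)" using assms that by (auto simp: ballot_set_def)
    also have "\<dots> \<le> card ({1..s} - T)" using assms(2) by (intro card_mono) auto
    finally show ?thesis .
  qed
  then show ?thesis using assms by (auto simp: ballot_set_def)
qed

text \<open>At the largest member the ballot condition compares all of \<open>S\<close> with
  non-members in \<open>{1..n}\<close>, so \<open>card S < n - card S\<close>.\<close>

lemma ballot_set_card_le:
  assumes "ballot_set n S"
  shows "card S \<le> (n - 1) div 2"
proof (cases "S = {}")
  case False
  have sub: "S \<subseteq> {1..n}" and fin: "finite S"
    using assms finite_subset by (auto simp: ballot_set_def)
  define s where "s = Max S"
  have s: "s \<in> S" and max: "\<And>t. t \<in> S \<Longrightarrow> t \<le> s" using fin False by (auto simp: s_def)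
  have "S \<subseteq> {1..s}" using max sub by fastforce
  then have "S \<inter> {1..s} = S" by blast
  then have "card S < card ({1..s} - S)" using assms s by (auto simp: ballot_set_def)
  also have "\<dots> \<le> card ({1..n} - S)" using s sub by (intro card_mono) auto
  also have "\<dots> = n - card S" using sub fin by (simp add: card_Diff_subset)
  finally show ?thesis by linarith
qed simp

lemma peak_poset_mono: "\<lbrakk>n > 0; S \<in> peak_poset n; T \<subseteq> S\<rbrakk> \<Longrightarrow> T \<in> peak_poset n"
  by (simp add: peak_poset_iff_ballot ballot_set_mono)

text \<open>The index shift makes the \<open>i\<close>-th coefficient count the sets of size
  \<open>i\<close>, and reversal turns its power into \<open>x ^ i\<close>. The size bound ensures
  that grouping the poset by cardinality loses no set.\<close>

lemma peak_polynomial_reverse: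
  assumes n: "n > 0" and x: "x \<noteq> (0::rat)"
  shows "x ^ ((n - 1) div 2) * poly (peak_polynomial n) (1 / x) = (\<Sum>S\<in>peak_poset n. x ^ card S)"
proof -
  define d where "d = (n - 1) div 2"
  have fin: "finite (peak_poset n)"
    by (rule finite_subset[of _ "Pow {1..n}"]) (auto simp: peak_poset_def)
  have img: "card ` peak_poset n \<subseteq> {0..d}"
    using n ballot_set_card_le by (auto simp: peak_poset_iff_ballot d_def)
  have "x ^ d * poly (peak_polynomial n) (1 / x) =
      (\<Sum>i = 0..d. of_nat (peak_number n (int i - 1)) * (x ^ d * (1 / x) ^ (d - i)))"
    by (simp add: peak_polynomial_def poly_sum poly_monom d_def sum_distrib_left mult_ac)
  also have "\<dots> = (\<Sum>i = 0..d. \<Sum>S\<in>{S \<in> peak_poset n. card S = i}. x ^ card S)"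
  proof (rule sum.cong[OF refl])
    fix i assume "i \<in> {0..d}"
    then have "x ^ d * (1 / x) ^ (d - i) = x ^ i"
      using x by (simp add: power_one_over power_diff field_simps)
    then show "of_nat (peak_number n (int i - 1)) * (x ^ d * (1 / x) ^ (d - i)) =
        (\<Sum>S\<in>{S \<in> peak_poset n. card S = i}. x ^ card S)"
      by (simp add: peak_number_def)
  qed
  also have "\<dots> = (\<Sum>S\<in>peak_poset n. x ^ card S)"
    by (rule sum.group[OF fin _ img]) simp
  finally show ?thesis by (simp add: d_def)
qed

section \<open>Counting chain monomials\<close>

text \<open>These are the monomials not divisible by any generator of the incomparability
  ideal.\<close>

definition chain_monom :: "(nat \<Rightarrow> nat set) \<Rightarrow> (nat \<Rightarrow>\<^sub>0 nat) \<Rightarrow> bool" where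
  "chain_monom S t \<longleftrightarrow>
     (\<forall>u\<in>Poly_Mapping.keys t. \<forall>v\<in>Poly_Mapping.keys t. S u \<subseteq> S v \<or> S v \<subseteq> S u)"

text \<open>The variable set \<open>D\<close> is a parameter because the recursion on the degree
  restricts it to the variables below a chosen one.\<close>

definition chain_monoms :: "(nat \<Rightarrow> nat set) \<Rightarrow> nat set \<Rightarrow> nat \<Rightarrow> (nat \<Rightarrow>\<^sub>0 nat) set" where
  "chain_monoms S D k = {t. Poly_Mapping.keys t \<subseteq> D \<and> total_degree t = k \<and> chain_monom S t}"

section \<open>Degrees and supports of monomials\<close>

lemma total_degree_superset:
  "\<lbrakk>finite V; Poly_Mapping.keys t \<subseteq> V\<rbrakk> \<Longrightarrow> total_degree t = (\<Sum>v\<in>V. Poly_Mapping.lookup t v)"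
  unfolding total_degree_def by (rule sum.mono_neutral_left) (auto simp: in_keys_iff)

lemma keys_add_nat:
  "Poly_Mapping.keys (s + t) = Poly_Mapping.keys s \<union> Poly_Mapping.keys (t :: 'a \<Rightarrow>\<^sub>0 nat)"
  by (auto simp: in_keys_iff lookup_add)

lemma total_degree_add: "total_degree (s + t) = total_degree s + total_degree t"
proof -
  define V where "V = Poly_Mapping.keys s \<union> Poly_Mapping.keys t"
  have "finite V" "Poly_Mapping.keys s \<subseteq> V" "Poly_Mapping.keys t \<subseteq> V"
      "Poly_Mapping.keys (s + t) \<subseteq> V"
    by (auto simp: V_def keys_add_nat)
  then show ?thesis
    by (simp add: total_degree_superset[of V] lookup_add sum.distrib)
qed

lemma total_degree_single [simp]: "total_degree (Poly_Mapping.single u a) = a"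
  by (simp add: total_degree_def)

lemma total_degree_eq_0_iff: "total_degree t = 0 \<longleftrightarrow> t = 0"
  by (auto simp: total_degree_def in_keys_iff intro!: poly_mapping_eqI)

section \<open>Recursion on the degree for chain monomials\<close>

lemma chain_monoms_0: "chain_monoms S D 0 = {0}"
  by (auto simp: chain_monoms_def total_degree_eq_0_iff chain_monom_def)

text \<open>One factor whose set is largest in the support is split off; all remaining factors lie
  below it.\<close>

lemma chain_monoms_Suc:
  "chain_monoms S D (Suc k) =
     (\<Union>u\<in>D. (+) (Poly_Mapping.single u 1) ` chain_monoms S {w\<in>D. S w \<subseteq> S u} k)"
proof (intro subset_antisym subsetI)
  fix t assume t: "t \<in> chain_monoms S D (Suc k)"
  then have ne: "Poly_Mapping.keys t \<noteq> {}"
    by (auto simp: chain_monoms_def total_degree_def)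
  then obtain X where X: "X \<in> S ` Poly_Mapping.keys t"
    and max: "\<And>Y. Y \<in> S ` Poly_Mapping.keys t \<Longrightarrow> X \<subseteq> Y \<Longrightarrow> Y = X"
    using finite_has_maximal[of "S ` Poly_Mapping.keys t"] by auto
  then obtain u where u: "u \<in> Poly_Mapping.keys t" "X = S u" by blast
  \<comment> \<open>In a chain a maximal member is the greatest one.\<close>
  have top: "S w \<subseteq> S u" if "w \<in> Poly_Mapping.keys t" for w
    using max[of "S w"] that t u by (auto simp: chain_monoms_def chain_monom_def)
  define r where "r = t - Poly_Mapping.single u 1"
  have tr: "t = Poly_Mapping.single u 1 + r"
    using u(1) by (intro poly_mapping_eqI)
      (auto simp: r_def lookup_add lookup_minus lookup_single in_keys_iff when_def)
  have sub: "Poly_Mapping.keys r \<subseteq> Poly_Mapping.keys t" 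
    using arg_cong[OF tr, of Poly_Mapping.keys] by (auto simp: keys_add_nat)
  have "total_degree r = k" using t tr by (auto simp: chain_monoms_def total_degree_add)
  moreover have "chain_monom S r" using t sub unfolding chain_monoms_def chain_monom_def by blast
  ultimately have "r \<in> chain_monoms S {w\<in>D. S w \<subseteq> S u} k"
    using t sub top by (auto simp: chain_monoms_def)
  moreover have "u \<in> D" using u t by (auto simp: chain_monoms_def)
  ultimately show "t \<in> (\<Union>u\<in>D. (+) (Poly_Mapping.single u 1) ` chain_monoms S {w\<in>D. S w \<subseteq> S u} k)"
    using tr by blast
next
  fix t assume "t \<in> (\<Union>u\<in>D. (+) (Poly_Mapping.single u 1) ` chain_monoms S {w\<in>D. S w \<subseteq> S u} k)"
  then obtain u r where "u \<in> D" "r \<in> chain_monoms S {w\<in>D. S w \<subseteq> S u} k"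
    and t: "t = Poly_Mapping.single u 1 + r" by blast
  then show "t \<in> chain_monoms S D (Suc k)"
    by (auto simp: chain_monoms_def chain_monom_def keys_add_nat total_degree_add)
qed

lemma finite_chain_monoms: "finite D \<Longrightarrow> finite (chain_monoms S D k)"
  by (induction k arbitrary: D) (auto simp: chain_monoms_0 chain_monoms_Suc)

text \<open>The union in the recursion is disjoint: the split-off set is the greatest one in the
  support, and injectivity of \<open>S\<close> recovers its index.\<close>

lemma card_chain_monoms_Suc:
  assumes fin: "finite D" and inj: "inj_on S D"
  shows "card (chain_monoms S D (Suc k)) = (\<Sum>u\<in>D. card (chain_monoms S {w\<in>D. S w \<subseteq> S u} k))"
proof -
  have "u = u'"
    if "u \<in> D" "u' \<in> D" "r \<in> chain_monoms S {w\<in>D. S w \<subseteq> S u} k"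
      "r' \<in> chain_monoms S {w\<in>D. S w \<subseteq> S u'} k"
      and eq: "Poly_Mapping.single u 1 + r = Poly_Mapping.single u' 1 + r'" for u u' r r'
  proof -
    have "insert u (Poly_Mapping.keys r) = insert u' (Poly_Mapping.keys r')"
      using arg_cong[OF eq, of Poly_Mapping.keys] by (simp add: keys_add_nat)
    then have "S u \<subseteq> S u'" "S u' \<subseteq> S u" using that(3,4) by (auto simp: chain_monoms_def)
    then show ?thesis using inj that(1,2) by (auto dest: inj_onD)
  qed
  then have disj: "(+) (Poly_Mapping.single u 1) ` chain_monoms S {w\<in>D. S w \<subseteq> S u} k \<inter>
      (+) (Poly_Mapping.single u' 1) ` chain_monoms S {w\<in>D. S w \<subseteq> S u'} k = {}"
    if "u \<in> D" "u' \<in> D" "u \<noteq> u'" for u u'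
    using that by (auto simp: disjoint_iff)
  have "card (chain_monoms S D (Suc k)) =
      (\<Sum>u\<in>D. card ((+) (Poly_Mapping.single u 1) ` chain_monoms S {w\<in>D. S w \<subseteq> S u} k))"
    unfolding chain_monoms_Suc
    by (rule card_UN_disjoint) (use fin disj in \<open>simp_all add: finite_chain_monoms\<close>)
  then show ?thesis by (simp add: card_image)
qed

section \<open>Multichains below a fixed set\<close>

lemma sum_Pow_power_card:
  fixes a :: "'a :: comm_semiring_1"
  assumes "finite A"
  shows "(\<Sum>X\<in>Pow A. a ^ card X) = (a + 1) ^ card A"
  using prod_add[OF assms, of "\<lambda>_. a" "\<lambda>_. 1"] by simp

text \<open>Below \<open>S v\<close> lies the full Boolean lattice of its subsets. A multichain of
  \<open>k\<close> subsets is fixed by choosing, for each element of \<open>S v\<close>, one of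
  \<open>k + 1\<close> moments to enter (or never). The induction splits off the top set and sums by
  the binomial theorem.\<close>

lemma card_chain_monoms_principal:
  assumes fin: "finite D" and inj: "inj_on S D"
    and down: "\<And>u X. \<lbrakk>u \<in> D; X \<subseteq> S u\<rbrakk> \<Longrightarrow> X \<in> S ` D"
    and finS: "\<And>u. u \<in> D \<Longrightarrow> finite (S u)"
    and "v \<in> D"
  shows "card (chain_monoms S {w\<in>D. S w \<subseteq> S v} k) = Suc k ^ card (S v)"
  using \<open>v \<in> D\<close>
proof (induction k arbitrary: v)
  case 0
  then show ?case by (simp add: chain_monoms_0)
next
  case (Suc k)
  define E where "E = {w\<in>D. S w \<subseteq> S v}"
  have "card (chain_monoms S E (Suc k)) = (\<Sum>u\<in>E. card (chain_monoms S {w\<in>E. S w \<subseteq> S u} k))"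
    using fin inj by (intro card_chain_monoms_Suc) (auto simp: E_def intro: inj_on_subset)
  also have "\<dots> = (\<Sum>u\<in>E. Suc k ^ card (S u))"
  proof (rule sum.cong[OF refl])
    fix u assume u: "u \<in> E"
    then have "{w\<in>E. S w \<subseteq> S u} = {w\<in>D. S w \<subseteq> S u}" by (auto simp: E_def)
    then show "card (chain_monoms S {w\<in>E. S w \<subseteq> S u} k) = Suc k ^ card (S u)"
      using Suc.IH u by (simp add: E_def)
  qed
  \<comment> \<open>Closure under subsets makes \<open>S\<close> a bijection from the indices below
    \<open>v\<close> onto the power set of \<open>S v\<close>.\<close>
  also have "\<dots> = (\<Sum>X\<in>Pow (S v). Suc k ^ card X)"
  proof (rule sum.reindex_bij_betw)
    show "bij_betw S E (Pow (S v))"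
    proof (rule bij_betw_imageI)
      show "inj_on S E" using inj by (auto simp: E_def intro: inj_on_subset)
      show "S ` E = Pow (S v)"
      proof (intro subset_antisym subsetI)
        fix X assume "X \<in> Pow (S v)"
        then obtain w where "w \<in> D" "X = S w" using down[OF Suc.prems] by blast
        then show "X \<in> S ` E" using \<open>X \<in> Pow (S v)\<close> by (auto simp: E_def)
      qed (auto simp: E_def)
    qed
  qed
  also have "\<dots> = Suc (Suc k) ^ card (S v)"
    using sum_Pow_power_card[OF finS[OF Suc.prems], of "Suc k"] by simp
  finally show ?case by (simp add: E_def)
qed

text \<open>Once the top factor \<open>u\<close> is removed, degree \<open>k - 1\<close> remains
  below \<open>S u\<close>, so the principal count has base \<open>(k - 1) + 1 = k\<close>.\<close>

lemma card_chain_monoms: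
  assumes "finite D" and "inj_on S D"
    and "\<And>u X. \<lbrakk>u \<in> D; X \<subseteq> S u\<rbrakk> \<Longrightarrow> X \<in> S ` D"
    and "\<And>u. u \<in> D \<Longrightarrow> finite (S u)"
    and "k > 0"
  shows "card (chain_monoms S D k) = (\<Sum>u\<in>D. k ^ card (S u))"
proof -
  obtain j where "k = Suc j" using \<open>k > 0\<close> by (cases k) auto
  then show ?thesis
    using assms card_chain_monoms_principal[of D S] by (simp add: card_chain_monoms_Suc)
qed

section \<open>Bases of the graded components\<close>

lemma carrier_mpoly_ring:
  "f \<in> carrier (mpoly_ring V) \<longleftrightarrow> (\<forall>t\<in>Poly_Mapping.keys f. Poly_Mapping.keys t \<subseteq> V)"
  by (simp add: mpoly_ring_def)

lemma mpoly_ring_simps [simp]: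
  "mult (mpoly_ring V) = times" "one (mpoly_ring V) = 1"
  "zero (mpoly_ring V) = 0" "add (mpoly_ring V) = plus"
  by (simp_all add: mpoly_ring_def)

lemma mpoly_ring_closed:
  fixes f g :: "'k::field mpoly"
  assumes "f \<in> carrier (mpoly_ring V)" and "g \<in> carrier (mpoly_ring V)"
  shows "f + g \<in> carrier (mpoly_ring V)" and "- f \<in> carrier (mpoly_ring V)"
    and "f * g \<in> carrier (mpoly_ring V)"
proof -
  show "f + g \<in> carrier (mpoly_ring V)"
    using assms keys_add[of f g] by (auto simp: carrier_mpoly_ring)
  show "- f \<in> carrier (mpoly_ring V)"
    using assms by (auto simp: carrier_mpoly_ring in_keys_iff)
  show "f * g \<in> carrier (mpoly_ring V)"
    unfolding carrier_mpoly_ring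
  proof
    fix t assume "t \<in> Poly_Mapping.keys (f * g)"
    then obtain a b where "a \<in> Poly_Mapping.keys f" "b \<in> Poly_Mapping.keys g" "t = a + b"
      using keys_mult[of f g] by blast
    then show "Poly_Mapping.keys t \<subseteq> V"
      using assms by (auto simp: carrier_mpoly_ring keys_add_nat)
  qed
qed

lemma cring_mpoly_ring: "cring (mpoly_ring V :: 'k::field mpoly ring)"
proof (rule cringI)
  show "abelian_group (mpoly_ring V :: 'k mpoly ring)"
  proof (rule abelian_groupI)
    fix x :: "'k mpoly" assume "x \<in> carrier (mpoly_ring V)"
    then show "\<exists>y\<in>carrier (mpoly_ring V). y \<oplus>\<^bsub>mpoly_ring V\<^esub> x = \<zero>\<^bsub>mpoly_ring V\<^esub>"
      using mpoly_ring_closed(2)[of x V x] by (intro bexI[of _ "- x"]) auto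
  qed (auto simp: mpoly_ring_closed(1) add_ac, simp add: carrier_mpoly_ring)
  show "comm_monoid (mpoly_ring V :: 'k mpoly ring)"
    by (rule comm_monoidI) (auto simp: mpoly_ring_closed(3) mult_ac, simp add: carrier_mpoly_ring)
qed (simp add: distrib_right)

lemma mpoly_ring_minus:
  fixes f g :: "'k::field mpoly"
  assumes "f \<in> carrier (mpoly_ring V)" and "g \<in> carrier (mpoly_ring V)"
  shows "f \<ominus>\<^bsub>mpoly_ring V\<^esub> g = f - g"
proof -
  interpret cring "mpoly_ring V :: 'k mpoly ring" by (rule cring_mpoly_ring)
  have "\<ominus>\<^bsub>mpoly_ring V\<^esub> g = - g"
    using assms mpoly_ring_closed by (intro minus_equality) auto
  then show ?thesis by (simp add: a_minus_def)
qed

section \<open>The incomparability ideal as a monomial ideal\<close>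

lemma lookup_sum_single:
  "finite T \<Longrightarrow> Poly_Mapping.lookup (\<Sum>t\<in>T. Poly_Mapping.single t (c t)) u = (if u \<in> T then c u else 0)"
  by (simp add: lookup_sum lookup_single when_def)

text \<open>The span of the monomials divisible by a generator: the explicit form of the
  incomparability ideal, in which membership is read off the coefficients.\<close>

definition nonchain_polys :: "nat \<Rightarrow> (nat \<Rightarrow> nat set) \<Rightarrow> 'k::field mpoly set" where
  "nonchain_polys m S =
     {f \<in> carrier (mpoly_ring {1..m}). \<forall>t\<in>Poly_Mapping.keys f. \<not> chain_monom S t}"

lemma chain_monom_addD: "chain_monom S (s + t) \<Longrightarrow> chain_monom S s"
  by (auto simp: chain_monom_def keys_add_nat)

text \<open>Multiplying by a monomial only enlarges a support, so an incomparable pair in it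
  persists.\<close>

lemma ideal_nonchain_polys: "ideal (nonchain_polys m S) (mpoly_ring {1..m} :: 'k::field mpoly ring)"
proof -
  define R :: "'k mpoly ring" where "R = mpoly_ring {1..m}"
  interpret cring R unfolding R_def by (rule cring_mpoly_ring)
  have l: "x * a \<in> nonchain_polys m S" if "a \<in> nonchain_polys m S" "x \<in> carrier R" for a x
  proof -
    have "\<not> chain_monom S t" if t: "t \<in> Poly_Mapping.keys (x * a)" for t
    proof -
      obtain u v where "v \<in> Poly_Mapping.keys a" "t = v + u"
        using keys_mult[of x a] t by (force simp: add.commute)
      then show ?thesis
        using \<open>a \<in> nonchain_polys m S\<close> chain_monom_addD by (auto simp: nonchain_polys_def)
    qed
    then show ?thesis
      using that mpoly_ring_closed by (auto simp: nonchain_polys_def R_def)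
  qed
  have "subgroup (nonchain_polys m S) (add_monoid R)"
  proof (rule add.subgroupI)
    show "nonchain_polys m S \<subseteq> carrier R" by (auto simp: nonchain_polys_def R_def)
    have "0 \<in> (nonchain_polys m S :: 'k mpoly set)"
      by (simp add: nonchain_polys_def carrier_mpoly_ring)
    then show "(nonchain_polys m S :: 'k mpoly set) \<noteq> {}" by blast
  next
    fix a assume a: "a \<in> (nonchain_polys m S :: 'k mpoly set)"
    have "\<ominus>\<^bsub>R\<^esub> a = - a"
      using a mpoly_ring_closed(2)[of a "{1..m}"]
      by (intro minus_equality) (auto simp: R_def nonchain_polys_def)
    then show "\<ominus>\<^bsub>R\<^esub> a \<in> nonchain_polys m S"
      using a mpoly_ring_closed(2)[of a "{1..m}"] by (auto simp: nonchain_polys_def in_keys_iff)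
  next
    fix a b assume "a \<in> (nonchain_polys m S :: 'k mpoly set)" "b \<in> (nonchain_polys m S :: 'k mpoly set)"
    then show "a \<oplus>\<^bsub>R\<^esub> b \<in> nonchain_polys m S"
      using keys_add[of a b] mpoly_ring_closed(1)[of a "{1..m}" b]
      by (auto simp: nonchain_polys_def R_def)
  qed
  then have "ideal (nonchain_polys m S) R"
    by (rule idealI[OF ring_axioms]) (use l in \<open>auto simp: R_def mult.commute\<close>)
  then show ?thesis by (simp add: R_def)
qed

text \<open>Minimality of the generated ideal gives one inclusion. For the other, each non-chain
  monomial is a multiple of some \<open>mvar i * mvar j\<close>, and a polynomial is the sum of its
  terms.\<close>

lemma incomparability_ideal_eq:
  "incomparability_ideal m S = (nonchain_polys m S :: 'k::field mpoly set)"
proof -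
  define R :: "'k mpoly ring" where "R = mpoly_ring {1..m}"
  define X where "X = {mvar i * mvar j :: 'k mpoly | i j. i \<in> {1..m} \<and> j \<in> {1..m}
    \<and> \<not> S i \<subseteq> S j \<and> \<not> S j \<subseteq> S i}"
  interpret cring R unfolding R_def by (rule cring_mpoly_ring)
  have XN: "X \<subseteq> nonchain_polys m S"
    by (auto simp: X_def mvar_def mult_single nonchain_polys_def carrier_mpoly_ring
        chain_monom_def keys_add_nat)
  then have XR: "X \<subseteq> carrier R" by (auto simp: nonchain_polys_def R_def)
  have I: "incomparability_ideal m S = Idl\<^bsub>R\<^esub> X"
    by (simp add: incomparability_ideal_def R_def X_def)
  interpret J: ideal "Idl\<^bsub>R\<^esub> X" R by (rule genideal_ideal[OF XR])
  have mono: "Poly_Mapping.single t c \<in> Idl\<^bsub>R\<^esub> X"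
    if t: "\<not> chain_monom S t" "Poly_Mapping.keys t \<subseteq> {1..m}" for t c
  proof -
    obtain i j where ij: "i \<in> Poly_Mapping.keys t" "j \<in> Poly_Mapping.keys t"
      "\<not> S i \<subseteq> S j" "\<not> S j \<subseteq> S i"
      using t by (auto simp: chain_monom_def)
    \<comment> \<open>Subtraction of exponents is truncated, but nothing is lost: \<open>i\<close>
      and \<open>j\<close> are distinct, being incomparable, and both occur in
      \<open>t\<close>.\<close>
    define r where "r = t - Poly_Mapping.single i 1 - Poly_Mapping.single j 1"
    have tr: "t = r + (Poly_Mapping.single i 1 + Poly_Mapping.single j 1)"
      using ij by (intro poly_mapping_eqI)
        (auto simp: r_def lookup_add lookup_minus lookup_single in_keys_iff when_def)
    have "Poly_Mapping.keys r \<subseteq> {1..m}"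
      using t(2) by (subst (asm) tr) (auto simp: keys_add_nat)
    then have "Poly_Mapping.single r c \<in> carrier R"
      by (auto simp: R_def carrier_mpoly_ring)
    moreover have "mvar i * mvar j \<in> Idl\<^bsub>R\<^esub> X"
      by (rule subsetD[OF genideal_self[OF XR]]) (use ij t(2) in \<open>unfold X_def, blast\<close>)
    ultimately have "Poly_Mapping.single r c * (mvar i * mvar j) \<in> Idl\<^bsub>R\<^esub> X"
      using J.I_l_closed by (auto simp: R_def)
    then show ?thesis by (subst tr) (simp add: mvar_def mult_single)
  qed
  have "Idl\<^bsub>R\<^esub> X \<subseteq> nonchain_polys m S"
    by (rule genideal_minimal[OF _ XN]) (unfold R_def, rule ideal_nonchain_polys)
  moreover have "nonchain_polys m S \<subseteq> Idl\<^bsub>R\<^esub> X"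
  proof
    fix f :: "'k mpoly" assume f: "f \<in> nonchain_polys m S"
    have "(\<Sum>t\<in>T. Poly_Mapping.single t (Poly_Mapping.lookup f t)) \<in> Idl\<^bsub>R\<^esub> X"
      if "finite T" "T \<subseteq> Poly_Mapping.keys f" for T
      using that
    proof (induction T)
      case empty
      then show ?case using J.zero_closed by (simp add: R_def)
    next
      case (insert t T)
      then have "Poly_Mapping.single t (Poly_Mapping.lookup f t) \<in> Idl\<^bsub>R\<^esub> X"
        using f by (intro mono) (auto simp: nonchain_polys_def carrier_mpoly_ring)
      then show ?case using insert J.a_closed by (auto simp: R_def)
    qed
    moreover have "f = (\<Sum>t\<in>Poly_Mapping.keys f. Poly_Mapping.single t (Poly_Mapping.lookup f t))"
      by (intro poly_mapping_eqI) (simp add: lookup_sum_single in_keys_iff)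
    ultimately show "f \<in> Idl\<^bsub>R\<^esub> X" by (metis finite_keys order_refl)
  qed
  ultimately show ?thesis by (simp add: I)
qed

lemma ideal_incomparability_ideal:
  "ideal (incomparability_ideal m S) (mpoly_ring {1..m} :: 'k::field mpoly ring)"
  unfolding incomparability_ideal_eq by (rule ideal_nonchain_polys)

text \<open>The coefficients at chain monomials are a complete invariant of a coset; this yields the
  linear independence of the chain monomials in the quotient.\<close>

lemma incomparability_coset_eq_iff:
  fixes f g :: "'k::field mpoly"
  assumes "f \<in> carrier (mpoly_ring {1..m})" and "g \<in> carrier (mpoly_ring {1..m})"
  shows "incomparability_ideal m S +>\<^bsub>mpoly_ring {1..m}\<^esub> f =
           incomparability_ideal m S +>\<^bsub>mpoly_ring {1..m}\<^esub> g \<longleftrightarrow>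
         (\<forall>t. chain_monom S t \<longrightarrow> Poly_Mapping.lookup f t = Poly_Mapping.lookup g t)"
proof -
  interpret cring "mpoly_ring {1..m} :: 'k mpoly ring" by (rule cring_mpoly_ring)
  have "f - g \<in> carrier (mpoly_ring {1..m})"
    using minus_closed[OF assms] unfolding mpoly_ring_minus[OF assms] .
  then have "f - g \<in> nonchain_polys m S \<longleftrightarrow>
      (\<forall>t. chain_monom S t \<longrightarrow> Poly_Mapping.lookup f t = Poly_Mapping.lookup g t)"
    by (auto simp: nonchain_polys_def in_keys_iff lookup_minus)
  then show ?thesis
    using quotient_eq_iff_same_a_r_cos[OF ideal_incomparability_ideal assms, of S]
    unfolding mpoly_ring_minus[OF assms] unfolding incomparability_ideal_eq by simp
qed

section \<open>The ground field inside the quotient\<close>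

lemma ring_hom_chain_algebra:
  "ring_hom_ring (mpoly_ring {1..m}) (chain_algebra m S :: 'k::field mpoly set ring)
     ((+>\<^bsub>mpoly_ring {1..m}\<^esub>) (incomparability_ideal m S))"
  unfolding chain_algebra_def by (rule ideal.rcos_ring_hom_ring[OF ideal_incomparability_ideal])

lemma mconst_carrier [simp]: "mconst c \<in> carrier (mpoly_ring V)"
  by (auto simp: mconst_def carrier_mpoly_ring)

lemma subfield_mconst: "subfield (range mconst) (mpoly_ring V :: 'k::field mpoly ring)"
proof -
  interpret cring "mpoly_ring V :: 'k mpoly ring" by (rule cring_mpoly_ring)
  have [simp]: "mconst c * mconst d = (mconst (c * d) :: 'k mpoly)"
    "mconst c + mconst d = (mconst (c + d) :: 'k mpoly)" for c d
    by (simp_all add: mconst_def mult_single single_add)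
  have one: "1 = (mconst 1 :: 'k mpoly)" and zero: "0 = (mconst 0 :: 'k mpoly)"
    by (simp_all add: mconst_def)
  have "mconst c = mconst d \<longleftrightarrow> c = d" for c d :: 'k
    by (simp add: mconst_def inj_eq)
  then have [simp]: "mconst c = (1 :: 'k mpoly) \<longleftrightarrow> c = 1" "mconst c = (0 :: 'k mpoly) \<longleftrightarrow> c = 0" for c
    unfolding one zero by blast+
  show ?thesis
  proof (rule subfieldI)
    have "subring (range mconst) (mpoly_ring V :: 'k mpoly ring)"
    proof (rule subringI)
      show "\<one>\<^bsub>mpoly_ring V\<^esub> \<in> range (mconst :: 'k \<Rightarrow> _)" by (auto simp: one)
      fix h assume "h \<in> range (mconst :: 'k \<Rightarrow> _)"
      then obtain c where "h = mconst c" by blast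
      then have "\<ominus>\<^bsub>mpoly_ring V\<^esub> h = mconst (- c)" by (intro minus_equality) auto
      then show "\<ominus>\<^bsub>mpoly_ring V\<^esub> h \<in> range mconst" by blast
    qed auto
    then show "subcring (range mconst) (mpoly_ring V :: 'k mpoly ring)" by (rule subcringI')
    show "Units ((mpoly_ring V)\<lparr>carrier := range mconst\<rparr>) =
        range mconst - {\<zero>\<^bsub>mpoly_ring V :: 'k mpoly ring\<^esub>}"
    proof -
      have "\<exists>d. d * c = 1 \<and> c * d = 1" if "c \<noteq> 0" for c :: 'k
        using that by (intro exI[of _ "inverse c"]) auto
      then show ?thesis by (auto simp: Units_def)
    qed
  qed
qed

text \<open>A homomorphism into a nonzero ring carries a subfield to a subfield. The quotient is
  nonzero because the monomial 1 has empty support, which is trivially a chain.\<close>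

lemma subfield_chain_scalars:
  "subfield (chain_scalars m S) (chain_algebra m S :: 'k::field mpoly set ring)"
proof -
  interpret h: ring_hom_ring "mpoly_ring {1..m} :: 'k mpoly ring" "chain_algebra m S"
    "(+>\<^bsub>mpoly_ring {1..m}\<^esub>) (incomparability_ideal m S)"
    by (rule ring_hom_chain_algebra)
  have "\<one>\<^bsub>chain_algebra m S\<^esub> \<noteq> (\<zero>\<^bsub>chain_algebra m S\<^esub> :: 'k mpoly set)"
  proof
    assume eq: "\<one>\<^bsub>chain_algebra m S\<^esub> = (\<zero>\<^bsub>chain_algebra m S\<^esub> :: 'k mpoly set)"
    have "(1 :: 'k mpoly) \<in> carrier (mpoly_ring {1..m})" "(0 :: 'k mpoly) \<in> carrier (mpoly_ring {1..m})"
      by (simp_all add: carrier_mpoly_ring)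
    moreover have "chain_monom S 0" by (simp add: chain_monom_def)
    ultimately have "Poly_Mapping.lookup (1 :: 'k mpoly) 0 = Poly_Mapping.lookup (0 :: 'k mpoly) 0"
      using incomparability_coset_eq_iff[of "1 :: 'k mpoly" m 0 S] eq h.hom_one h.hom_zero
      unfolding mpoly_ring_simps by metis
    then show False by (simp add: lookup_one)
  qed
  moreover have "chain_scalars m S =
      (+>\<^bsub>mpoly_ring {1..m}\<^esub>) (incomparability_ideal m S) ` range (mconst :: 'k \<Rightarrow> _)"
    by (auto simp: chain_scalars_def)
  ultimately show ?thesis using h.img_is_subfield(2)[OF subfield_mconst] by simp
qed

section \<open>Dimensions of spans of chain monomials\<close>

text \<open>Induction on \<open>T\<close>: each further monomial extends the span by a line, and its
  class is new because its coefficient distinguishes it from every combination of the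
  others.\<close>

lemma dimension_chain_monoms:
  assumes "finite T" and "\<And>t. t \<in> T \<Longrightarrow> chain_monom S t \<and> Poly_Mapping.keys t \<subseteq> {1..m}"
  shows "ring.dimension (chain_algebra m S) (card T) (chain_scalars m S)
           {incomparability_ideal m S +>\<^bsub>mpoly_ring {1..m}\<^esub> f | f :: 'k::field mpoly.
              Poly_Mapping.keys f \<subseteq> T}"
  using assms
proof (induction T)
  case empty
  interpret h: ring_hom_ring "mpoly_ring {1..m} :: 'k mpoly ring" "chain_algebra m S"
    "(+>\<^bsub>mpoly_ring {1..m}\<^esub>) (incomparability_ideal m S)"
    by (rule ring_hom_chain_algebra)
  have "{incomparability_ideal m S +>\<^bsub>mpoly_ring {1..m}\<^esub> f | f :: 'k mpoly.
      Poly_Mapping.keys f \<subseteq> {}} = {\<zero>\<^bsub>chain_algebra m S\<^esub>}"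
    using h.hom_zero by auto
  then show ?case using ring.zero_dim[OF h.S.ring_axioms] by simp
next
  case (insert t T)
  interpret h: ring_hom_ring "mpoly_ring {1..m} :: 'k mpoly ring" "chain_algebra m S"
    "(+>\<^bsub>mpoly_ring {1..m}\<^esub>) (incomparability_ideal m S)"
    by (rule ring_hom_chain_algebra)
  define q :: "'k mpoly \<Rightarrow> 'k mpoly set" where
    "q = (+>\<^bsub>mpoly_ring {1..m}\<^esub>) (incomparability_ideal m S)"
  define E where "E T = {q f | f. Poly_Mapping.keys f \<subseteq> T}" for T
  define x :: "'k mpoly" where "x = Poly_Mapping.single t 1"
  have K: "chain_scalars m S = {q (mconst c) | c. True}" by (simp add: chain_scalars_def q_def)
  have x: "x \<in> carrier (mpoly_ring {1..m})"
    using insert.prems by (auto simp: x_def carrier_mpoly_ring)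
  have sub: "f \<in> carrier (mpoly_ring {1..m})" if "Poly_Mapping.keys f \<subseteq> insert t T" for f :: "'k mpoly"
    using that insert.prems unfolding carrier_mpoly_ring by blast
  \<comment> \<open>An element of the line extension is the class of a polynomial with one term at
    \<open>t\<close> added.\<close>
  have comb: "q (mconst c) \<otimes>\<^bsub>chain_algebra m S\<^esub> q x \<oplus>\<^bsub>chain_algebra m S\<^esub> q g =
      q (Poly_Mapping.single t c + g)" if g: "Poly_Mapping.keys g \<subseteq> T" for c g
  proof -
    have g': "g \<in> carrier (mpoly_ring {1..m})" using g by (intro sub) auto
    have "mconst c * x = Poly_Mapping.single t c" by (simp add: mconst_def x_def mult_single)
    then have "q (Poly_Mapping.single t c + g) = q ((mconst c \<otimes>\<^bsub>mpoly_ring {1..m}\<^esub> x) \<oplus>\<^bsub>mpoly_ring {1..m}\<^esub> g)"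
      by simp
    also have "\<dots> = q (mconst c) \<otimes>\<^bsub>chain_algebra m S\<^esub> q x \<oplus>\<^bsub>chain_algebra m S\<^esub> q g"
      unfolding q_def using x g' h.R.m_closed[OF mconst_carrier x] by (simp only: h.hom_add h.hom_mult mconst_carrier)
    finally show ?thesis by simp
  qed
  have "q x \<notin> E T"
  proof
    assume "q x \<in> E T"
    then obtain f where f: "q x = q f" "Poly_Mapping.keys f \<subseteq> T" by (auto simp: E_def)
    then have "Poly_Mapping.lookup x t = Poly_Mapping.lookup f t"
      using incomparability_coset_eq_iff[OF x sub, of f S] insert.prems unfolding q_def by blast
    moreover have "t \<notin> Poly_Mapping.keys f" using f insert.hyps by blast
    ultimately show False by (simp add: x_def in_keys_iff)
  qed
  moreover have "h.S.dimension (card T) (chain_scalars m S) (E T)"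
    using insert unfolding E_def q_def by simp
  moreover have "q x \<in> carrier (chain_algebra m S)" unfolding q_def using x by (rule h.hom_closed)
  ultimately have "h.S.dimension (Suc (card T)) (chain_scalars m S)
      (h.S.line_extension (chain_scalars m S) (q x) (E T))"
    by (intro ring.Suc_dim[OF h.S.ring_axioms])
  moreover have "h.S.line_extension (chain_scalars m S) (q x) (E T) = E (insert t T)"
  proof (intro subset_antisym subsetI)
    fix u assume "u \<in> h.S.line_extension (chain_scalars m S) (q x) (E T)"
    then obtain c g where g: "Poly_Mapping.keys g \<subseteq> T" and
      u: "u = q (mconst c) \<otimes>\<^bsub>chain_algebra m S\<^esub> q x \<oplus>\<^bsub>chain_algebra m S\<^esub> q g"
      unfolding h.S.line_extension_mem_iff K E_def by blast
    have "Poly_Mapping.keys (Poly_Mapping.single t c + g) \<subseteq> insert t T"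
      using keys_add[of "Poly_Mapping.single t c" g] g by (auto split: if_splits)
    then show "u \<in> E (insert t T)" unfolding u comb[OF g] E_def by blast
  next
    fix u assume "u \<in> E (insert t T)"
    then obtain f where f: "u = q f" "Poly_Mapping.keys f \<subseteq> insert t T" by (auto simp: E_def)
    define g where "g = f - Poly_Mapping.single t (Poly_Mapping.lookup f t)"
    have g: "Poly_Mapping.keys g \<subseteq> T"
      using f(2) by (auto simp: g_def in_keys_iff lookup_minus lookup_single when_def split: if_splits)
    have "u = q (mconst (Poly_Mapping.lookup f t)) \<otimes>\<^bsub>chain_algebra m S\<^esub> q x \<oplus>\<^bsub>chain_algebra m S\<^esub> q g"
      unfolding comb[OF g] f by (simp add: g_def)
    then show "u \<in> h.S.line_extension (chain_scalars m S) (q x) (E T)"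
      unfolding h.S.line_extension_mem_iff K using g by (auto simp: E_def)
  qed
  ultimately show ?case using insert.hyps by (simp add: E_def q_def)
qed

text \<open>Deleting the non-chain terms of a homogeneous polynomial does not change its coset, so
  every class of degree \<open>k\<close> has a representative supported on chain monomials.\<close>

lemma chain_component_eq:
  "chain_component m S k =
     {incomparability_ideal m S +>\<^bsub>mpoly_ring {1..m}\<^esub> f | f :: 'k::field mpoly.
        Poly_Mapping.keys f \<subseteq> chain_monoms S {1..m} k}"
proof (intro subset_antisym subsetI)
  fix u :: "'k mpoly set" assume "u \<in> chain_component m S k"
  then obtain f where u: "u = incomparability_ideal m S +>\<^bsub>mpoly_ring {1..m}\<^esub> f"
    and f: "f \<in> carrier (mpoly_ring {1..m})" "homogeneous k f"
    by (auto simp: chain_component_def)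
  define g where "g = (\<Sum>t\<in>Poly_Mapping.keys f \<inter> Collect (chain_monom S).
    Poly_Mapping.single t (Poly_Mapping.lookup f t))"
  have look: "Poly_Mapping.lookup g t = (if chain_monom S t then Poly_Mapping.lookup f t else 0)" for t
    by (simp add: g_def lookup_sum_single in_keys_iff)
  have "Poly_Mapping.keys g \<subseteq> Poly_Mapping.keys f \<inter> Collect (chain_monom S)"
    by (auto simp: in_keys_iff look split: if_splits)
  then have g: "Poly_Mapping.keys g \<subseteq> chain_monoms S {1..m} k"
    using f by (fastforce simp: chain_monoms_def homogeneous_def carrier_mpoly_ring)
  then have "g \<in> carrier (mpoly_ring {1..m})"
    by (auto simp: carrier_mpoly_ring chain_monoms_def)
  then have "u = incomparability_ideal m S +>\<^bsub>mpoly_ring {1..m}\<^esub> g"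
    unfolding u using f by (subst incomparability_coset_eq_iff) (auto simp: look)
  then show "u \<in> {incomparability_ideal m S +>\<^bsub>mpoly_ring {1..m}\<^esub> f | f :: 'k mpoly.
        Poly_Mapping.keys f \<subseteq> chain_monoms S {1..m} k}" using g by blast
next
  fix u :: "'k mpoly set"
  assume "u \<in> {incomparability_ideal m S +>\<^bsub>mpoly_ring {1..m}\<^esub> f | f :: 'k mpoly.
        Poly_Mapping.keys f \<subseteq> chain_monoms S {1..m} k}"
  then obtain f where u: "u = incomparability_ideal m S +>\<^bsub>mpoly_ring {1..m}\<^esub> f"
    and "Poly_Mapping.keys f \<subseteq> chain_monoms S {1..m} k" by blast
  then have "f \<in> carrier (mpoly_ring {1..m}) \<and> homogeneous k f"
    unfolding chain_monoms_def carrier_mpoly_ring homogeneous_def by blast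
  then show "u \<in> chain_component m S k" unfolding u chain_component_def by blast
qed

lemma dimension_chain_component:
  "ring.dimension (chain_algebra m S :: 'k::field mpoly set ring)
     (card (chain_monoms S {1..m} k)) (chain_scalars m S) (chain_component m S k)"
  unfolding chain_component_eq
  by (rule dimension_chain_monoms) (rule finite_chain_monoms, simp, simp add: chain_monoms_def)

section \<open>The Hilbert polynomial\<close>

text \<open>Dimension over a subfield is well defined, so two candidates agree at all large integers
  and their difference has infinitely many roots. This justifies the \<open>THE\<close> in
  \<open>hilbert_polynomial\<close>.\<close>

lemma is_hilbert_polynomial_unique:
  assumes "ring A" and "subfield K A"
    and P: "is_hilbert_polynomial A K G P" and Q: "is_hilbert_polynomial A K G Q"
  shows "P = Q"
proof -
  obtain M N where M: "\<And>k. k \<ge> M \<Longrightarrow> \<exists>d. ring.dimension A d K (G k) \<and> poly P (of_nat k) = of_nat d"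
    and N: "\<And>k. k \<ge> N \<Longrightarrow> \<exists>d. ring.dimension A d K (G k) \<and> poly Q (of_nat k) = of_nat d"
    using P Q by (auto simp: is_hilbert_polynomial_def)
  have "poly (P - Q) (of_nat k) = 0" if "k \<ge> max M N" for k
  proof -
    have "k \<ge> M" "k \<ge> N" using that by auto
    then show ?thesis
      using M N ring.dimension_is_inj[OF \<open>ring A\<close> \<open>subfield K A\<close>] by fastforce
  qed
  then have "of_nat ` {max M N..} \<subseteq> {x. poly (P - Q) x = 0}" by auto
  moreover have "infinite (of_nat ` {max M N..} :: rat set)"
    by (simp add: finite_image_iff inj_on_def infinite_Ici)
  ultimately have "infinite {x. poly (P - Q) x = 0}" using finite_subset by blast
  then have "P - Q = 0" using poly_roots_finite by blast
  then show ?thesis by simp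
qed

lemma hilbert_polynomial_eqI:
  assumes "ring A" and "subfield K A" and "is_hilbert_polynomial A K G P"
  shows "hilbert_polynomial A K G = P"
  unfolding hilbert_polynomial_def using assms is_hilbert_polynomial_unique
  by (intro the_equality) blast+

lemma is_hilbert_polynomial_chain_algebra:
  assumes inj: "inj_on S {1..m}"
    and down: "\<And>u X. \<lbrakk>u \<in> {1..m}; X \<subseteq> S u\<rbrakk> \<Longrightarrow> X \<in> S ` {1..m}"
    and fin: "\<And>u. u \<in> {1..m} \<Longrightarrow> finite (S u)"
  shows "is_hilbert_polynomial (chain_algebra m S :: 'k::field mpoly set ring) (chain_scalars m S)
           (chain_component m S) (\<Sum>X\<in>S ` {1..m}. Polynomial.monom 1 (card X))"
  unfolding is_hilbert_polynomial_def
\<comment> \<open>The count of chain monomials is a sum of powers of the degree from degree 1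
  onwards.\<close>
proof (rule exI[of _ 1], intro allI impI)
  fix k :: nat assume "1 \<le> k"
  then have "card (chain_monoms S {1..m} k) = (\<Sum>u\<in>{1..m}. k ^ card (S u))"
    by (intro card_chain_monoms[OF _ inj down fin]) auto
  then have "poly (\<Sum>X\<in>S ` {1..m}. Polynomial.monom 1 (card X)) (of_nat k :: rat) =
      of_nat (card (chain_monoms S {1..m} k))"
    by (simp only: sum.reindex[OF inj] o_def poly_sum poly_monom of_nat_sum of_nat_power mult_1)
  then show "\<exists>d. ring.dimension (chain_algebra m S :: 'k mpoly set ring) d (chain_scalars m S)
      (chain_component m S k) \<and>
      poly (\<Sum>X\<in>S ` {1..m}. Polynomial.monom 1 (card X)) (of_nat k :: rat) = of_nat d"
    using dimension_chain_component by blast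
qed

text \<open>The first conjunct certifies that the description by \<open>THE\<close> denotes an
  actual Hilbert polynomial. The second is stated for nonzero \<open>x\<close>, where
  \<open>1 / x\<close> is a genuine inverse; these infinitely many values determine the
  polynomial.\<close>

theorem theorem4p1:
  fixes n m :: nat
    and S :: "nat \<Rightarrow> nat set"
    and A :: "'k::field mpoly set ring"
    and K :: "'k mpoly set set"
    and G :: "nat \<Rightarrow> 'k mpoly set set"
  assumes "n \<ge> 3"
    and "m = card (peak_poset n)"
    and "bij_betw S {1..m} (peak_poset n)"
    and "A = chain_algebra m S"
    and "K = chain_scalars m S"
    and "G = chain_component m S"
  shows "is_hilbert_polynomial A K G (hilbert_polynomial A K G) \<and>
         (\<forall>x::rat. x \<noteq> 0 \<longrightarrow>
            poly (hilbert_polynomial A K G) x =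
              x ^ ((n - 1) div 2) * poly (peak_polynomial n) (1 / x))"
proof -
  \<comment> \<open>Both sides meet in this polynomial: it counts the chain monomials of each
    positive degree, and it is the reversed peak polynomial.\<close>
  define P where "P = (\<Sum>X\<in>peak_poset n. Polynomial.monom (1 :: rat) (card X))"
  have n: "n > 0" using assms(1) by simp
  have inj: "inj_on S {1..m}" and img: "S ` {1..m} = peak_poset n"
    using assms(3) by (auto simp: bij_betw_def)
  have "X \<in> S ` {1..m}" if "u \<in> {1..m}" "X \<subseteq> S u" for u X
    using that peak_poset_mono[OF n] img by blast
  moreover have "finite (S u)" if "u \<in> {1..m}" for u
  proof -
    have "S u \<in> peak_poset n" using that img by blast
    then show ?thesis by (auto simp: peak_poset_def intro: finite_subset)
  qed
  ultimately have HP: "is_hilbert_polynomial A K G P"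
    using is_hilbert_polynomial_chain_algebra[OF inj] unfolding assms(4-6) P_def img by blast
  have "ring A"
    using ring_hom_chain_algebra unfolding assms(4) by (rule ring_hom_ring.axioms(2))
  then have H: "hilbert_polynomial A K G = P"
    using subfield_chain_scalars HP unfolding assms(4-6) by (intro hilbert_polynomial_eqI)
  show ?thesis
    using HP peak_polynomial_reverse[OF n] unfolding H by (simp add: P_def poly_sum poly_monom)
qed

end
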